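(* For every $g\in\mathbb{R}^T$, $$\{A\subseteq T\mid \mathrm{OPT}(g)\subseteq\mathrm{SOL}(A)\}=\{A^*(f)\mid f \text{ is an optimal solution of } (\mathrm{P}_g)\},$$ where $(\mathrm{P}_g)$ is the problem $\min\{B(f')\mid f'\in\mathbb{R}^T\text{ is a super-reparametrization of }g\}$.
   Context: Fix a structure $(D,V,C)$: $V$ is a finite set of variables, $D$ a finite nonempty domain, $C\subseteq 2^V$ a set of non-empty subsets of $V$ (scopes). For $S\subseteq V$, $D^S$ is the set of maps $S\to D$; for an assignment $x\in D^V$, $x[S]\in D^S$ is its restriction to $S$. Tuples: $T_S=\{(S,k)\mid k\in D^S\}$ for $S\in C$ and $T=\bigcup_{S\in C}T_S$. A CSP is a subset $A\subseteq T$ (of allowed tuples); its solution set is $\mathrm{SOL}(A)=\{x\in D^V\mid (S,x[S])\in A\ \forall S\in C\}$. A WCSP is a vector $f\in\mathbb{R}^T$. The map $\phi\colon D^V\to\{0,1\}^T$ is defined by $\phi_{(S,k)}(x)=1$ if $x[S]=k$ and $0$ otherwise, so the WCSP objective is $\langle f,\phi(x)\rangle=\sum_{S\in C}f_{(S,x[S])}$. $\mathrm{OPT}(f)=\operatorname{argmax}_{x\in D^V}\langle f,\phi(x)\rangle\subseteq D^V$ is the set of optimal assignments. A WCSP $f$ is a super-reparametrization of $g$ if $\langle f,\phi(x)\rangle\ge\langle g,\phi(x)\rangle$ for all $x\in D^V$. Upper bound: $B(f)=\sum_{S\in C}\max_{t\in T_S}f_t$. A tuple $t\in T_S$ is active for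 $f$ if $f_t=\max_{t'\in T_S}f_{t'}$; $A^*(f)\subseteq T$ is the set of all tuples active for $f$, viewed as a CSP. *)

theory Defs
  imports Complex_Main "HOL-Library.FuncSet"
begin

text \<open>
  Maps from \<open>S\<close> to \<open>D\<close> and vectors in \<open>\<real>\<^sup>T\<close> are extensional functions, so that equality of
  functions is equality of maps on the intended index set.
\<close>

type_synonym ('v, 'd) tuple = "'v set \<times> ('v \<Rightarrow> 'd)"

definition assignments :: "'d set \<Rightarrow> 'v set \<Rightarrow> ('v \<Rightarrow> 'd) set" where
  "assignments D S = S \<rightarrow>\<^sub>E D"

definition scope_tuples :: "'d set \<Rightarrow> 'v set \<Rightarrow> ('v, 'd) tuple set" where
  "scope_tuples D S = {(S, k) | k. k \<in> assignments D S}"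

definition tuples :: "'d set \<Rightarrow> 'v set set \<Rightarrow> ('v, 'd) tuple set" where
  "tuples D C = (\<Union>S\<in>C. scope_tuples D S)"

definition SOL :: "'d set \<Rightarrow> 'v set \<Rightarrow> 'v set set \<Rightarrow> ('v, 'd) tuple set \<Rightarrow> ('v \<Rightarrow> 'd) set" where
  "SOL D V C A = {x \<in> assignments D V. \<forall>S\<in>C. (S, restrict x S) \<in> A}"

definition WCSPs :: "'d set \<Rightarrow> 'v set set \<Rightarrow> (('v, 'd) tuple \<Rightarrow> real) set" where
  "WCSPs D C = tuples D C \<rightarrow>\<^sub>E UNIV"

definition phi :: "('v \<Rightarrow> 'd) \<Rightarrow> ('v, 'd) tuple \<Rightarrow> real" where
  "phi x = (\<lambda>(S, k). if restrict x S = k then 1 else 0)"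

definition objective ::
    "'d set \<Rightarrow> 'v set set \<Rightarrow> (('v, 'd) tuple \<Rightarrow> real) \<Rightarrow> ('v \<Rightarrow> 'd) \<Rightarrow> real" where
  "objective D C f x = (\<Sum>t\<in>tuples D C. f t * phi x t)"

definition OPT ::
    "'d set \<Rightarrow> 'v set \<Rightarrow> 'v set set \<Rightarrow> (('v, 'd) tuple \<Rightarrow> real) \<Rightarrow> ('v \<Rightarrow> 'd) set" where
  "OPT D V C f = {x. is_arg_max (objective D C f) (\<lambda>y. y \<in> assignments D V) x}"

definition super_reparametrization ::
    "'d set \<Rightarrow> 'v set \<Rightarrow> 'v set set \<Rightarrow>
      (('v, 'd) tuple \<Rightarrow> real) \<Rightarrow> (('v, 'd) tuple \<Rightarrow> real) \<Rightarrow> bool" where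
  "super_reparametrization D V C f g \<longleftrightarrow>
     (\<forall>x\<in>assignments D V. objective D C f x \<ge> objective D C g x)"

definition upper_bound :: "'d set \<Rightarrow> 'v set set \<Rightarrow> (('v, 'd) tuple \<Rightarrow> real) \<Rightarrow> real" where
  "upper_bound D C f = (\<Sum>S\<in>C. Max (f ` scope_tuples D S))"

definition active_tuples ::
    "'d set \<Rightarrow> 'v set set \<Rightarrow> (('v, 'd) tuple \<Rightarrow> real) \<Rightarrow> ('v, 'd) tuple set" where
  "active_tuples D C f = (\<Union>S\<in>C. {t \<in> scope_tuples D S. f t = Max (f ` scope_tuples D S)})"

definition optimal_super_reparametrization ::
    "'d set \<Rightarrow> 'v set \<Rightarrow> 'v set set \<Rightarrow>
      (('v, 'd) tuple \<Rightarrow> real) \<Rightarrow> (('v, 'd) tuple \<Rightarrow> real) \<Rightarrow> bool" where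
  "optimal_super_reparametrization D V C g f \<longleftrightarrow>
     is_arg_min (upper_bound D C)
       (\<lambda>f'. f' \<in> WCSPs D C \<and> super_reparametrization D V C f' g) f"

lemma objective_eq_sum_scopes:
  assumes V: "finite V" and D: "finite D" and C: "C \<subseteq> Pow V" and x: "x \<in> assignments D V"
  shows "objective D C f x = (\<Sum>S\<in>C. f (S, restrict x S))"
proof -
  have finC: "finite C"
    using V C by (meson finite_Pow_iff finite_subset)
  have finT: "finite (scope_tuples D S)" if "S \<in> C" for S
  proof -
    have "finite S"
      using that V C by (meson PowD finite_subset subsetD)
    then have "finite (assignments D S)"
      using D by (simp add: assignments_def finite_PiE)
    moreover have "scope_tuples D S = Pair S ` assignments D S"
      by (auto simp: scope_tuples_def)
    ultimately show ?thesis by simp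
  qed
  have "objective D C f x = (\<Sum>S\<in>C. \<Sum>t\<in>scope_tuples D S. f t * phi x t)"
    unfolding objective_def tuples_def
    by (rule sum.UNION_disjoint) (use finC finT in \<open>auto simp: scope_tuples_def\<close>)
  also have "\<dots> = (\<Sum>S\<in>C. f (S, restrict x S))"
  proof (rule sum.cong[OF refl])
    fix S assume S: "S \<in> C"
    have mem: "(S, restrict x S) \<in> scope_tuples D S"
      using x C S by (auto simp: scope_tuples_def assignments_def PiE_iff)
    have "(\<Sum>t\<in>scope_tuples D S. f t * phi x t)
        = (\<Sum>t\<in>scope_tuples D S. if t = (S, restrict x S) then f t else 0)"
      by (rule sum.cong) (auto simp: scope_tuples_def phi_def split: if_splits)
    also have "\<dots> = f (S, restrict x S)"
      using mem finT[OF S] by simp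
    finally show "(\<Sum>t\<in>scope_tuples D S. f t * phi x t) = f (S, restrict x S)" .
  qed
  finally show ?thesis .
qed

end

theory Submission
  imports Defs
begin

text \<open>
  Let \<open>m\<close> be the maximum of the objective of \<open>g\<close>. Every super-reparametrization \<open>f\<close> of \<open>g\<close> has
  \<open>B(f) \<ge> m\<close>, and if \<open>B(f) = m\<close> then at each optimal assignment of \<open>g\<close> all the scopewise
  inequalities are tight, so that it satisfies the CSP of active tuples. Conversely, let \<open>A\<close> be
  satisfied by all optimal assignments and let \<open>x0\<close> be one of them. Give each tuple with scope \<open>S\<close>
  the weight \<open>g (S, x0[S])\<close>, lowered by \<open>e > 0\<close> if the tuple is not in \<open>A\<close>. This WCSP has upper
  bound \<open>m\<close> and active tuples \<open>A\<close>, and it is a super-reparametrization of \<open>g\<close> as soon as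
  \<open>|C| e\<close> is at most the gap between \<open>m\<close> and the values of non-optimal assignments.
\<close>

locale wcsp_structure =
  fixes D :: "'d set" and V :: "'v set" and C :: "'v set set"
  assumes finite_V: "finite V" and finite_D: "finite D" and D_nonempty: "D \<noteq> {}"
    and C_subset: "C \<subseteq> Pow V"
begin

lemma finite_C: "finite C"
  using finite_V C_subset by (meson finite_Pow_iff finite_subset)

lemma finite_assignments: "finite (assignments D V)"
  by (simp add: assignments_def finite_PiE finite_V finite_D)

lemma assignments_nonempty: "assignments D V \<noteq> {}"
  by (simp add: assignments_def PiE_eq_empty_iff D_nonempty)

lemma finite_scope_tuples:
  assumes "S \<in> C"
  shows "finite (scope_tuples D S)"
proof -
  have "finite S"
    using assms finite_V C_subset by (meson PowD finite_subset subsetD)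
  then have "finite (assignments D S)"
    by (simp add: assignments_def finite_PiE finite_D)
  moreover have "scope_tuples D S = Pair S ` assignments D S"
    by (auto simp: scope_tuples_def)
  ultimately show ?thesis by simp
qed

lemma restrict_in_scope_tuples:
  "x \<in> assignments D V \<Longrightarrow> S \<in> C \<Longrightarrow> (S, restrict x S) \<in> scope_tuples D S"
  using C_subset by (auto simp: scope_tuples_def assignments_def PiE_iff)

lemmas objective_eq = objective_eq_sum_scopes[OF finite_V finite_D C_subset]

lemma le_Max_scope:
  assumes "x \<in> assignments D V" "S \<in> C"
  shows "f (S, restrict x S) \<le> Max (f ` scope_tuples D S)"
  using assms by (intro Max_ge finite_imageI finite_scope_tuples imageI restrict_in_scope_tuples)

lemma objective_le_upper_bound:
  "x \<in> assignments D V \<Longrightarrow> objective D C f x \<le> upper_bound D C f"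
  by (auto simp: objective_eq upper_bound_def intro: sum_mono le_Max_scope)

text \<open>Two equal finite sums whose terms are ordered termwise agree in every term.\<close>

lemma objective_eq_upper_bound_imp_SOL:
  assumes x: "x \<in> assignments D V" and eq: "objective D C f x = upper_bound D C f"
  shows "x \<in> SOL D V C (active_tuples D C f)"
proof -
  have "f (S, restrict x S) = Max (f ` scope_tuples D S)" if "S \<in> C" for S
  proof (rule sum_mono_inv[OF _ _ that finite_C])
    show "(\<Sum>S\<in>C. f (S, restrict x S)) = (\<Sum>S\<in>C. Max (f ` scope_tuples D S))"
      using eq x by (simp add: objective_eq upper_bound_def)
  qed (rule le_Max_scope[OF x])
  then show ?thesis
    using x restrict_in_scope_tuples[OF x] by (auto simp: SOL_def active_tuples_def)
qed

lemma OPT_iff: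
  "x \<in> OPT D V C g \<longleftrightarrow> x \<in> assignments D V \<and>
     (\<forall>y\<in>assignments D V. objective D C g y \<le> objective D C g x)"
  by (auto simp: OPT_def is_arg_max_linorder)

lemma OPT_nonempty: "OPT D V C g \<noteq> {}"
proof -
  have "Max (objective D C g ` assignments D V) \<in> objective D C g ` assignments D V"
    by (simp add: finite_assignments assignments_nonempty)
  then obtain x where "x \<in> assignments D V"
    and "objective D C g x = Max (objective D C g ` assignments D V)"
    by force
  then have "x \<in> OPT D V C g"
    by (simp add: OPT_iff finite_assignments)
  then show ?thesis by blast
qed

text \<open>There are finitely many assignments, so the non-optimal ones stay below the maximum by a
  uniform positive amount, which is shared out among the scopes.\<close>

lemma optimality_gap:
  assumes x0: "x0 \<in> OPT D V C g"
  obtains e where "e > 0"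
    and "\<And>x. x \<in> assignments D V \<Longrightarrow> x \<notin> OPT D V C g \<Longrightarrow>
           objective D C g x + of_nat (card C) * e \<le> objective D C g x0"
proof -
  \<comment> \<open>The extra element 1 keeps the set nonempty when every assignment is
    optimal.\<close>
  define gaps where
    "gaps = insert 1 ((\<lambda>x. objective D C g x0 - objective D C g x) ` (assignments D V - OPT D V C g))"
  \<comment> \<open>Adding 1 to the denominator avoids division by zero for empty
    \<open>C\<close>.\<close>
  define e where "e = Min gaps / (of_nat (card C) + 1)"
  have fin: "finite gaps"
    by (simp add: gaps_def finite_assignments)
  have "d > 0" if "d \<in> gaps" for d
    using that x0 by (force simp: gaps_def OPT_iff not_le)
  then have "Min gaps > 0"
    using fin by (subst Min_gr_iff) (auto simp: gaps_def)
  then have e: "e > 0" and "of_nat (card C) * e \<le> Min gaps"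
    by (auto simp: e_def field_simps)
  moreover have "Min gaps \<le> objective D C g x0 - objective D C g x"
    if "x \<in> assignments D V" "x \<notin> OPT D V C g" for x
    using that fin by (intro Min_le) (auto simp: gaps_def)
  ultimately have "objective D C g x + of_nat (card C) * e \<le> objective D C g x0"
    if "x \<in> assignments D V" "x \<notin> OPT D V C g" for x
    using that by (smt (verit))
  with e show ?thesis by (rule that)
qed

lemma exists_tight_super_reparametrization:
  assumes A: "A \<subseteq> tuples D C" and sol: "OPT D V C g \<subseteq> SOL D V C A" and x0: "x0 \<in> OPT D V C g"
  obtains f where "f \<in> WCSPs D C" and "super_reparametrization D V C f g"
    and "upper_bound D C f = objective D C g x0" and "active_tuples D C f = A"
proof -
  obtain e where e: "e > 0"
    and gap: "\<And>x. x \<in> assignments D V \<Longrightarrow> x \<notin> OPT D V C g \<Longrightarrow>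
           objective D C g x + of_nat (card C) * e \<le> objective D C g x0"
    using optimality_gap[OF x0] by blast
  have x0V: "x0 \<in> assignments D V"
    using x0 by (simp add: OPT_iff)
  have x0A: "(S, restrict x0 S) \<in> A" if "S \<in> C" for S
    using that x0 sol by (auto simp: SOL_def)
  \<comment> \<open>Within a scope \<open>w\<close> takes at most two values, and the tuple of
    \<open>x0\<close> has the larger one because it lies in \<open>A\<close>.\<close>
  define w where "w t = g (fst t, restrict x0 (fst t)) - (if t \<in> A then 0 else e)" for t
  define f where "f = restrict w (tuples D C)"
  have f: "f t = g (S, restrict x0 S) - (if t \<in> A then 0 else e)"
    if "S \<in> C" "t \<in> scope_tuples D S" for S t
    using that by (auto simp: f_def w_def tuples_def scope_tuples_def)
  have Max: "Max (f ` scope_tuples D S) = g (S, restrict x0 S)" if S: "S \<in> C" for S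
  proof (rule Max_eqI)
    show "finite (f ` scope_tuples D S)"
      using S by (simp add: finite_scope_tuples)
    show "y \<le> g (S, restrict x0 S)" if "y \<in> f ` scope_tuples D S" for y
      using that e by (auto simp: f[OF S])
    show "g (S, restrict x0 S) \<in> f ` scope_tuples D S"
      using restrict_in_scope_tuples[OF x0V S] x0A[OF S]
      by (intro image_eqI[of _ _ "(S, restrict x0 S)"]) (auto simp: f[OF S])
  qed
  have "f \<in> WCSPs D C"
    by (simp add: f_def WCSPs_def)
  moreover have "super_reparametrization D V C f g"
    unfolding super_reparametrization_def
  proof
    fix x assume x: "x \<in> assignments D V"
    show "objective D C g x \<le> objective D C f x"
    proof (cases "x \<in> OPT D V C g")
      case True
      \<comment> \<open>An optimal assignment uses only tuples of \<open>A\<close>, so it incurs no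
        penalty.\<close>
      then have "f (S, restrict x S) = g (S, restrict x0 S)" if "S \<in> C" for S
        using that sol f[OF that restrict_in_scope_tuples[OF x that]] by (auto simp: SOL_def)
      then have "objective D C f x = objective D C g x0"
        by (simp add: objective_eq x x0V)
      then show ?thesis
        using x0 x by (simp add: OPT_iff)
    next
      case False
      \<comment> \<open>Any other assignment loses at most \<open>e\<close> per scope, which the gap
        absorbs.\<close>
      have "(\<Sum>S\<in>C. g (S, restrict x0 S) - e) \<le> (\<Sum>S\<in>C. f (S, restrict x S))"
        using e by (intro sum_mono) (simp add: f restrict_in_scope_tuples[OF x])
      then have "objective D C g x0 - of_nat (card C) * e \<le> objective D C f x"
        by (simp add: objective_eq x x0V sum_subtractf)
      with gap[OF x False] show ?thesis by simp
    qed
  qed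
  moreover have "upper_bound D C f = objective D C g x0"
    by (simp add: upper_bound_def Max objective_eq x0V)
  moreover have "active_tuples D C f = A"
  proof -
    \<comment> \<open>As \<open>e\<close> is strictly positive, lowered tuples are inactive.\<close>
    have "f t = Max (f ` scope_tuples D S) \<longleftrightarrow> t \<in> A" if "S \<in> C" "t \<in> scope_tuples D S" for S t
      using e by (simp add: Max[OF that(1)] f[OF that])
    then show ?thesis
      using A by (fastforce simp: active_tuples_def tuples_def)
  qed
  ultimately show ?thesis by (rule that)
qed

text \<open>Weak duality bounds \<open>upper_bound\<close> from below by the maximum of the
  objective of \<open>g\<close>; the construction above shows that this bound is attained.\<close>

lemma optimal_super_reparametrization_iff:
  assumes x0: "x0 \<in> OPT D V C g"
  shows "optimal_super_reparametrization D V C g f \<longleftrightarrow>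
           f \<in> WCSPs D C \<and> super_reparametrization D V C f g \<and>
           upper_bound D C f = objective D C g x0"
proof -
  have x0V: "x0 \<in> assignments D V"
    using x0 by (simp add: OPT_iff)
  have lower: "objective D C g x0 \<le> upper_bound D C f'"
    if "super_reparametrization D V C f' g" for f'
    using that x0V objective_le_upper_bound[OF x0V, of f']
    by (auto simp: super_reparametrization_def intro: order_trans)
  \<comment> \<open>Every assignment satisfies the CSP of all tuples, so the construction always
    applies to it.\<close>
  have "OPT D V C g \<subseteq> SOL D V C (tuples D C)"
    using restrict_in_scope_tuples unfolding OPT_iff SOL_def tuples_def subset_iff by blast
  from exists_tight_super_reparametrization[OF subset_refl this x0]
  obtain f' where "f' \<in> WCSPs D C" "super_reparametrization D V C f' g"
    and "upper_bound D C f' = objective D C g x0"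
    by blast
  with lower show ?thesis
    unfolding optimal_super_reparametrization_def is_arg_min_linorder by (metis order_antisym)
qed

text \<open>The characterization of optimality holds for any choice of optimal assignment, so it can
  be used at \<open>x\<close> itself: the objective of \<open>f\<close> at \<open>x\<close> is then
  squeezed between two copies of \<open>upper_bound D C f\<close>.\<close>

lemma OPT_subset_SOL_active_tuples:
  assumes "optimal_super_reparametrization D V C g f"
  shows "OPT D V C g \<subseteq> SOL D V C (active_tuples D C f)"
proof
  fix x assume x: "x \<in> OPT D V C g"
  then have xV: "x \<in> assignments D V"
    by (simp add: OPT_iff)
  have "super_reparametrization D V C f g" "upper_bound D C f = objective D C g x"
    using assms optimal_super_reparametrization_iff[OF x] by auto
  with xV have "upper_bound D C f \<le> objective D C f x"
    by (auto simp: super_reparametrization_def)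
  with objective_le_upper_bound[OF xV] show "x \<in> SOL D V C (active_tuples D C f)"
    by (intro objective_eq_upper_bound_imp_SOL[OF xV] antisym)
qed

end

theorem theorem10:
  fixes D :: "'d set" and V :: "'v set" and C :: "'v set set"
    and g :: "('v, 'd) tuple \<Rightarrow> real"
  assumes "finite V" and "finite D" and "D \<noteq> {}"
    and "C \<subseteq> Pow V" and "{} \<notin> C"
    and "g \<in> WCSPs D C"
  shows "{A. A \<subseteq> tuples D C \<and> OPT D V C g \<subseteq> SOL D V C A}
       = {active_tuples D C f | f. optimal_super_reparametrization D V C g f}"
proof -
  interpret wcsp_structure D V C
    using assms by unfold_locales
  obtain x0 where x0: "x0 \<in> OPT D V C g"
    using OPT_nonempty by blast
  show ?thesis
  proof (intro subset_antisym subsetI)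
    fix A assume "A \<in> {A. A \<subseteq> tuples D C \<and> OPT D V C g \<subseteq> SOL D V C A}"
    then obtain f where "f \<in> WCSPs D C" "super_reparametrization D V C f g"
      "upper_bound D C f = objective D C g x0" "active_tuples D C f = A"
      using exists_tight_super_reparametrization[OF _ _ x0] by blast
    then show "A \<in> {active_tuples D C f | f. optimal_super_reparametrization D V C g f}"
      using optimal_super_reparametrization_iff[OF x0] by blast
  next
    fix A assume "A \<in> {active_tuples D C f | f. optimal_super_reparametrization D V C g f}"
    moreover have "active_tuples D C f \<subseteq> tuples D C" for f
      by (auto simp: active_tuples_def tuples_def)
    ultimately show "A \<in> {A. A \<subseteq> tuples D C \<and> OPT D V C g \<subseteq> SOL D V C A}"
      using OPT_subset_SOL_active_tuples by blast
  qed
qed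

end
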